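(* Let $G$ be a group and $H$ a subgroup of $G$. Then $\mathrm{Occ}(H)\le \mathrm{Occ}(G)$.
   Context: For a group $G$ and a subgroup $K$, let $\chi_K\colon G\to\{0,1\}$ be the characteristic function of $K$, and let $A_G$ be the set of characteristic functions of all subgroups of $G$, partially ordered by equality. For $S\subseteq G$, $\chi_K$ is Occam on $S$ if $\chi_K$ is the only element of $A_G$ agreeing with $\chi_K$ on $S$. The radius $R_G(K)$ is $\min\{|S| : S\subseteq G,\ \chi_K \text{ is Occam on } S\}$ if finite and $\infty$ otherwise. Define $\mathrm{Occ}(G)=R_G(\{e\})$, the radius of the trivial subgroup of $G$ (computed within $A_G$); similarly $\mathrm{Occ}(H)=R_H(\{e\})$ computed within $A_H$. *)

theory Defs
  imports
    "HOL-Algebra.Group"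
    "HOL-Library.Extended_Nat"
    "HOL-Library.FuncSet"
    "HOL-Library.Indicator_Function"
begin

(* Functions on the group are represented extensionally: they are undefined outside the carrier,
   so that equality of HOL functions is equality of functions on the carrier. *)
definition char_fun :: "('a, 'b) monoid_scheme \<Rightarrow> 'a set \<Rightarrow> 'a \<Rightarrow> nat" where
  "char_fun G K = restrict (indicator K) (carrier G)"

definition subgroup_char_funs :: "('a, 'b) monoid_scheme \<Rightarrow> ('a \<Rightarrow> nat) set" where
  "subgroup_char_funs G = {char_fun G K | K. subgroup K G}"

(* The partial order on the family A is equality, so being Occam on S means being the only
   member of A with the given values on S. *)
definition occam_on :: "('a \<Rightarrow> nat) set \<Rightarrow> ('a \<Rightarrow> nat) \<Rightarrow> 'a set \<Rightarrow> bool" where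
  "occam_on A f S \<longleftrightarrow> f \<in> A \<and> (\<forall>g\<in>A. (\<forall>x\<in>S. g x = f x) \<longrightarrow> g = f)"

(* The infimum in enat of a nonempty set is its minimum, and that of the empty set is infinity.
   Finiteness of S is required explicitly because card is 0 on infinite sets. *)
definition radius :: "('a, 'b) monoid_scheme \<Rightarrow> 'a set \<Rightarrow> enat" where
  "radius G K =
    (INF S \<in> {S. S \<subseteq> carrier G \<and> finite S \<and> occam_on (subgroup_char_funs G) (char_fun G K) S}.
       enat (card S))"

definition Occ :: "('a, 'b) monoid_scheme \<Rightarrow> enat" where
  "Occ G = radius G {\<one>\<^bsub>G\<^esub>}"

end

theory Submission
  imports Defs
begin

text \<open>The trivial subgroup is Occam on S exactly when every nontrivial subgroup meets S in a
  non-identity element (\<open>occam_on_one_iff\<close>). This property passes to H: a subgroup K of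
  H is also a subgroup of G, and S meets K only inside H. So S \<inter> H serves for H whenever S
  serves for G, and it has no more elements than S.\<close>

lemma char_fun_eq_iff_on:
  assumes "S \<subseteq> carrier G"
  shows "(\<forall>x\<in>S. char_fun G K x = char_fun G L x) \<longleftrightarrow> K \<inter> S = L \<inter> S"
  using assms by (auto simp: char_fun_def indicator_def restrict_def split: if_splits)

lemma char_fun_eq_iff:
  assumes "K \<subseteq> carrier G" "L \<subseteq> carrier G"
  shows "char_fun G K = char_fun G L \<longleftrightarrow> K = L"
  using assms char_fun_eq_iff_on[of "carrier G" G K L] by (metis order_refl inf.absorb1)

text \<open>Agreement of the two characteristic functions on S says that K and {\<one>} have the
  same trace on S. Since K contains \<one>, one of the two inclusions is automatic and only K
  \<inter> S \<subseteq> {\<one>} remains.\<close>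

lemma (in group) occam_on_one_iff:
  assumes "S \<subseteq> carrier G"
  shows "occam_on (subgroup_char_funs G) (char_fun G {\<one>}) S \<longleftrightarrow>
    (\<forall>K. subgroup K G \<longrightarrow> K \<inter> S \<subseteq> {\<one>} \<longrightarrow> K = {\<one>})"
proof -
  have "(\<forall>x\<in>S. char_fun G K x = char_fun G {\<one>} x) \<longleftrightarrow> K \<inter> S \<subseteq> {\<one>}"
    and "char_fun G K = char_fun G {\<one>} \<longleftrightarrow> K = {\<one>}"
    if "subgroup K G" for K
    using subgroup.one_closed[OF that] subgroup.subset[OF that]
    by (auto simp: char_fun_eq_iff_on[OF assms] char_fun_eq_iff)
  then show ?thesis
    using triv_subgroup unfolding occam_on_def subgroup_char_funs_def by blast
qed

theorem theorem2p2:
  fixes G :: "('a, 'b) monoid_scheme" and H :: "'a set"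
  assumes "group G"
    and "subgroup H G"
  shows "Occ (G\<lparr>carrier := H\<rparr>) \<le> Occ G"
  unfolding Occ_def radius_def
\<comment> \<open>It suffices to find, for each S admissible in G, a set admissible in H that is no
  larger. If G has no admissible S, its radius is infinite and nothing is to be shown.\<close>
proof (rule INF_mono)
  interpret G: group G by fact
  interpret H: group "G\<lparr>carrier := H\<rparr>"
    using assms by (simp add: G.subgroup_imp_group)
  fix S
  assume "S \<in> {S. S \<subseteq> carrier G \<and> finite S \<and>
    occam_on (subgroup_char_funs G) (char_fun G {\<one>\<^bsub>G\<^esub>}) S}"
  then have S: "finite S"
    and occam: "\<And>K. subgroup K G \<Longrightarrow> K \<inter> S \<subseteq> {\<one>\<^bsub>G\<^esub>} \<Longrightarrow> K = {\<one>\<^bsub>G\<^esub>}"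
    using G.occam_on_one_iff by auto
  have "K = {\<one>\<^bsub>G\<^esub>}"
    if K: "subgroup K (G\<lparr>carrier := H\<rparr>)" and KS: "K \<inter> (S \<inter> H) \<subseteq> {\<one>\<^bsub>G\<^esub>}" for K
  proof (rule occam)
    show "subgroup K G" using G.incl_subgroup[OF assms(2) K] .
    \<comment> \<open>Since K lies in H, cutting S down to H loses no point of K \<inter> S.\<close>
    show "K \<inter> S \<subseteq> {\<one>\<^bsub>G\<^esub>}" using KS subgroup.subset[OF K] by auto
  qed
  then have "occam_on (subgroup_char_funs (G\<lparr>carrier := H\<rparr>))
      (char_fun (G\<lparr>carrier := H\<rparr>) {\<one>\<^bsub>G\<lparr>carrier := H\<rparr>\<^esub>}) (S \<inter> H)"
    \<comment> \<open>Only the carrier is updated, so H has the identity of G.\<close>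
    by (subst H.occam_on_one_iff) auto
  moreover have "card (S \<inter> H) \<le> card S"
    using S by (simp add: card_mono)
  ultimately show "\<exists>T\<in>{T. T \<subseteq> carrier (G\<lparr>carrier := H\<rparr>) \<and> finite T \<and>
      occam_on (subgroup_char_funs (G\<lparr>carrier := H\<rparr>))
        (char_fun (G\<lparr>carrier := H\<rparr>) {\<one>\<^bsub>G\<lparr>carrier := H\<rparr>\<^esub>}) T}. enat (card T) \<le> enat (card S)"
    using S by (intro bexI[of _ "S \<inter> H"]) auto
qed

end
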